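(* Let $\alpha>1$ be a real algebraic number whose minimal polynomial over $\mathbb{Q}$ is $\mathfrak{m}_\alpha(X)=X^3-aX^2+bX-c$ with $a,b,c$ positive integers. Assume that $\alpha$ is the unique positive root of $\mathfrak{m}_\alpha$ and that the additive monoid $\mathbb{N}_0[\alpha]$ is atomic. Then $\mathbb{N}_0[\alpha]$ is a proper LFM if and only if $b\le a^2$ and $\frac{b}{a}\le\left\lfloor\frac{c}{b}\right\rfloor$.
   Context: $\mathbb{N}=\{1,2,3,\dots\}$ and $\mathbb{N}_0=\mathbb{N}\cup\{0\}$. For $\alpha\in\mathbb{R}_{>0}$, $\mathbb{N}_0[\alpha]=\{f(\alpha): f(X)\in\mathbb{N}_0[X]\}\subseteq\mathbb{R}_{\ge 0}$, viewed as a commutative cancellative monoid under addition. For a commutative cancellative monoid $(M,+,0)$: a unit is an element with an additive inverse in $M$; a nonunit $u\in M\setminus\{0\}$ is an atom if $u=v+w$ with $v,w\in M$ implies that $v$ or $w$ is a unit; $M$ is atomic if every nonzero nonunit is a finite sum of atoms. If $M$ is atomic, a factorization of $x\in M\setminus\{0\}$ is an expression $x=u_1+\cdots+u_k$ with $k\in\mathbb{N}$ and all $u_i$ atoms, considered up to permutation of the atoms; its length is $k$. An atomic monoid $M$ is a UFM (unique factorization monoid) if every $x\neq 0$ has exactly one factorization; it is an LFM (length-factorial monoid) if for every $x\ne 0$ any two distinct factorizations of $x$ have different lengths; it is a proper LFM if it is an LFM but not a UFM. *)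

theory Defs
  imports Complex_Main "HOL-Library.Multiset" "HOL-Computational_Algebra.Polynomial"
begin

(* A commutative cancellative monoid is given as a subset M of a cancellative commutative
   ambient monoid, with M containing 0 and closed under addition. *)

definition add_submonoid :: "'a::cancel_comm_monoid_add set \<Rightarrow> bool" where
  "add_submonoid M \<longleftrightarrow> 0 \<in> M \<and> (\<forall>x\<in>M. \<forall>y\<in>M. x + y \<in> M)"

definition add_units :: "'a::cancel_comm_monoid_add set \<Rightarrow> 'a set" where
  "add_units M = {u \<in> M. \<exists>v\<in>M. u + v = 0}"

definition add_atoms :: "'a::cancel_comm_monoid_add set \<Rightarrow> 'a set" where
  "add_atoms M = {u \<in> M - {0}. u \<notin> add_units M \<and>
     (\<forall>v\<in>M. \<forall>w\<in>M. u = v + w \<longrightarrow> v \<in> add_units M \<or> w \<in> add_units M)}"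

(* Expressions u_1 + ... + u_k up to permutation of the summands are multisets;
   their length k is the size of the multiset, and k is at least 1. *)

definition factorizations :: "'a::cancel_comm_monoid_add set \<Rightarrow> 'a \<Rightarrow> 'a multiset set" where
  "factorizations M x = {A. A \<noteq> {#} \<and> set_mset A \<subseteq> add_atoms M \<and> sum_mset A = x}"

definition atomic_monoid :: "'a::cancel_comm_monoid_add set \<Rightarrow> bool" where
  "atomic_monoid M \<longleftrightarrow> add_submonoid M \<and>
     (\<forall>x\<in>M. x \<noteq> 0 \<and> x \<notin> add_units M \<longrightarrow>
        (\<exists>A. set_mset A \<subseteq> add_atoms M \<and> sum_mset A = x))"

definition UFM :: "'a::cancel_comm_monoid_add set \<Rightarrow> bool" where
  "UFM M \<longleftrightarrow> atomic_monoid M \<and> (\<forall>x\<in>M. x \<noteq> 0 \<longrightarrow> (\<exists>!A. A \<in> factorizations M x))"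

definition LFM :: "'a::cancel_comm_monoid_add set \<Rightarrow> bool" where
  "LFM M \<longleftrightarrow> atomic_monoid M \<and>
     (\<forall>x\<in>M. x \<noteq> 0 \<longrightarrow>
        (\<forall>A\<in>factorizations M x. \<forall>B\<in>factorizations M x. A \<noteq> B \<longrightarrow> size A \<noteq> size B))"

definition proper_LFM :: "'a::cancel_comm_monoid_add set \<Rightarrow> bool" where
  "proper_LFM M \<longleftrightarrow> LFM M \<and> \<not> UFM M"

definition nat_poly_values :: "real \<Rightarrow> real set" where
  "nat_poly_values \<alpha> = range (\<lambda>f :: nat poly. poly (map_poly of_nat f) \<alpha>)"

lemma add_submonoid_nat_poly_values: "add_submonoid (nat_poly_values \<alpha>)"
  unfolding add_submonoid_def
proof (intro conjI ballI)
  have "(0::real) = poly (map_poly of_nat (0 :: nat poly)) \<alpha>" by simp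
  then show "0 \<in> nat_poly_values \<alpha>" unfolding nat_poly_values_def by (rule range_eqI)
next
  fix x y assume "x \<in> nat_poly_values \<alpha>" "y \<in> nat_poly_values \<alpha>"
  then obtain f g :: "nat poly"
    where x: "x = poly (map_poly of_nat f) \<alpha>" and y: "y = poly (map_poly of_nat g) \<alpha>"
    unfolding nat_poly_values_def by blast
  have "map_poly of_nat (f + g) = (map_poly of_nat f + map_poly of_nat g :: real poly)"
    by (rule poly_eqI) (simp add: coeff_map_poly)
  then have "x + y = poly (map_poly of_nat (f + g)) \<alpha>" unfolding x y by simp
  then show "x + y \<in> nat_poly_values \<alpha>" unfolding nat_poly_values_def by (rule range_eqI)
qed

definition is_minimal_polynomial :: "rat poly \<Rightarrow> real \<Rightarrow> bool" where
  "is_minimal_polynomial p x \<longleftrightarrow>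
     lead_coeff p = 1 \<and> poly (map_poly of_rat p) x = 0 \<and>
     (\<forall>q :: rat poly. q \<noteq> 0 \<and> poly (map_poly of_rat q) x = 0 \<longrightarrow> degree p \<le> degree q)"

end

(* Every nonzero element of \<nat>\<^sub>0[\<alpha>] is at least 1, since \<alpha> > 1; so 0 is the only unit, the atoms are
   powers of \<alpha>, and they form an initial segment of the powers, because a decomposition of \<alpha>^j
   can be multiplied by \<alpha>.  As b > 0, the minimal polynomial m does not express \<alpha>^3 through lower
   powers, so 1, ..., \<alpha>^3 are atoms.  If \<alpha>^4 is an atom too, (X - 1) m gives two distinct
   factorizations of equal length.  If not, any two factorizations of an element differ by a
   multiple of m, and m 1 \<noteq> 0, so the monoid is length-factorial; it is not factorial because of m
   itself.  Hence it is a proper LFM iff \<alpha>^4 is not an atom, i.e. iff for some integer k the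
   polynomial (X + k) m = X^4 - (a - k) X^3 - (k a - b) X^2 - (c - k b) X - k c has no positive
   coefficient below the leading one, i.e. iff b / a \<le> k \<le> min a (c / b) for some k. *)
theory Submission
  imports Defs
begin

section \<open>Sums and sizes of multisets, counted over a finite superset of the support\<close>

lemma sum_mset_eq_sum_count:
  fixes A :: "real multiset"
  assumes "finite S" "set_mset A \<subseteq> S"
  shows "sum_mset A = (\<Sum>x\<in>S. real (count A x) * x)"
  using assms(2)
proof (induction A)
  case empty
  then show ?case by simp
next
  case (add y A)
  have "(\<Sum>x\<in>S. real (count (add_mset y A) x) * x)
      = (\<Sum>x\<in>S. real (count A x) * x + (if x = y then x else 0))"
    by (intro sum.cong) (auto simp: algebra_simps)
  also have "\<dots> = (\<Sum>x\<in>S. real (count A x) * x) + y"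
    using add.prems assms(1) by (simp add: sum.distrib)
  finally show ?case using add by simp
qed

lemma size_eq_sum_count:
  assumes "finite S" "set_mset A \<subseteq> S"
  shows "size A = (\<Sum>x\<in>S. count A x)"
  unfolding size_multiset_overloaded_eq
  by (rule sum.mono_neutral_left) (use assms in \<open>auto simp: not_in_iff\<close>)

section \<open>Elements of the monoid \<open>nat_poly_values \<alpha>\<close>\<close>

lemma poly_nonneg_coeffs:
  fixes p :: "real poly"
  assumes "\<And>i. coeff p i \<ge> 0" "x \<ge> 0"
  shows "poly p x \<ge> 0"
  unfolding poly_altdef using assms by (intro sum_nonneg mult_nonneg_nonneg zero_le_power)

lemma nat_poly_values_nonneg:
  assumes "x \<in> nat_poly_values \<alpha>" "\<alpha> \<ge> 0"
  shows "x \<ge> 0"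
  using assms unfolding nat_poly_values_def
  by (auto intro!: poly_nonneg_coeffs simp: coeff_map_poly)

lemma nat_poly_values_add:
  "x \<in> nat_poly_values \<alpha> \<Longrightarrow> y \<in> nat_poly_values \<alpha> \<Longrightarrow> x + y \<in> nat_poly_values \<alpha>"
  using add_submonoid_nat_poly_values unfolding add_submonoid_def by blast

lemma nat_poly_values_pCons:
  assumes "x \<in> nat_poly_values \<alpha>"
  shows "of_nat n + \<alpha> * x \<in> nat_poly_values \<alpha>"
proof -
  obtain f :: "nat poly" where f: "x = poly (map_poly of_nat f) \<alpha>"
    using assms unfolding nat_poly_values_def by blast
  have "map_poly of_nat (pCons n f) = pCons (of_nat n :: real) (map_poly of_nat f)"
    by (rule map_poly_pCons) simp
  then have "of_nat n + \<alpha> * x = poly (map_poly of_nat (pCons n f)) \<alpha>"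
    unfolding f by simp
  then show ?thesis unfolding nat_poly_values_def by (rule range_eqI)
qed

lemma nat_poly_values_zero [simp]: "0 \<in> nat_poly_values \<alpha>"
  using add_submonoid_nat_poly_values unfolding add_submonoid_def by blast

text \<open>Horner's scheme: prepending a coefficient to a polynomial acts on its value as in the
  \<open>pCons\<close> case, so inductions over coefficients can be stated for values alone.\<close>

lemma nat_poly_values_induct [consumes 1, case_names zero pCons]:
  assumes "x \<in> nat_poly_values \<alpha>"
    and "P 0"
    and "\<And>n x. x \<in> nat_poly_values \<alpha> \<Longrightarrow> P x \<Longrightarrow> P (of_nat n + \<alpha> * x)"
  shows "P x"
proof -
  obtain f :: "nat poly" where "x = poly (map_poly of_nat f) \<alpha>"
    using assms(1) unfolding nat_poly_values_def by blast
  moreover have "P (poly (map_poly of_nat f) \<alpha>)"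
  proof (induction f)
    case 0
    then show ?case using assms(2) by simp
  next
    case (pCons n f)
    have "map_poly of_nat (pCons n f) = pCons (of_nat n :: real) (map_poly of_nat f)"
      by (rule map_poly_pCons) simp
    moreover have "poly (map_poly of_nat f) \<alpha> \<in> nat_poly_values \<alpha>"
      unfolding nat_poly_values_def by (rule rangeI)
    ultimately show ?case using assms(3) pCons.IH by simp
  qed
  ultimately show ?thesis by simp
qed

lemma nat_poly_values_mult_power:
  assumes "x \<in> nat_poly_values \<alpha>"
  shows "\<alpha> ^ n * x \<in> nat_poly_values \<alpha>"
proof (induction n)
  case (Suc n)
  then show ?case using nat_poly_values_pCons[of _ \<alpha> 0] by (simp add: mult.assoc)
qed (use assms in simp)

lemma nat_poly_values_mult_nat:
  assumes "x \<in> nat_poly_values \<alpha>"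
  shows "of_nat n * x \<in> nat_poly_values \<alpha>"
  using assms by (induction n) (simp_all add: nat_poly_values_add algebra_simps)

lemma nat_poly_values_power [simp]: "\<alpha> ^ n \<in> nat_poly_values \<alpha>"
  using nat_poly_values_mult_power[OF nat_poly_values_pCons[OF nat_poly_values_zero, of 1]] by simp

text \<open>Some coefficient is positive, and lowering it by one keeps all coefficients natural.
  Hence only powers of \<alpha> can be atoms.\<close>

lemma nat_poly_values_split_power:
  assumes "x \<in> nat_poly_values \<alpha>" "x \<noteq> 0"
  shows "\<exists>n. \<exists>y\<in>nat_poly_values \<alpha>. x = \<alpha> ^ n + y"
  using assms
proof (induction rule: nat_poly_values_induct)
  case (pCons k x)
  show ?case
  proof (cases k)
    case 0
    with pCons obtain n y where "y \<in> nat_poly_values \<alpha>" "x = \<alpha> ^ n + y" by auto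
    moreover from this have "\<alpha> * y \<in> nat_poly_values \<alpha>"
      using nat_poly_values_pCons[of y \<alpha> 0] by simp
    ultimately show ?thesis
      using 0 by (intro exI[of _ "Suc n"] bexI[of _ "\<alpha> * y"]) (simp_all add: algebra_simps)
  next
    case (Suc l)
    then show ?thesis
      using pCons nat_poly_values_pCons[of x \<alpha> l]
      by (intro exI[of _ 0] bexI[of _ "of_nat l + \<alpha> * x"]) simp_all
  qed
qed simp

lemma nat_poly_values_ge_one:
  assumes "x \<in> nat_poly_values \<alpha>" "x \<noteq> 0" "\<alpha> > 1"
  shows "x \<ge> 1"
proof -
  obtain n y where "y \<in> nat_poly_values \<alpha>" "x = \<alpha> ^ n + y"
    using nat_poly_values_split_power assms by blast
  then show ?thesis
    using nat_poly_values_nonneg[of y \<alpha>] one_le_power[of \<alpha> n] assms(3) by linarith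
qed

text \<open>A single term of degree at least \<open>n\<close> would already reach
  \<open>\<alpha> ^ n\<close>, so only lower powers occur. The bound \<open>n\<close> is arbitrary
  in the induction because each Horner step divides by \<alpha> and lowers it by one.\<close>

lemma nat_poly_values_below_power:
  assumes "x \<in> nat_poly_values \<alpha>" "x < \<alpha> ^ n" "\<alpha> > 1"
  shows "\<exists>f :: nat \<Rightarrow> nat. x = (\<Sum>i<n. real (f i) * \<alpha> ^ i)"
  using assms(1,2)
proof (induction arbitrary: n rule: nat_poly_values_induct)
  case zero
  show ?case by (rule exI[of _ "\<lambda>_. 0"]) simp
next
  case (pCons k x)
  have x: "x \<ge> 0" using nat_poly_values_nonneg[OF pCons(1)] assms(3) by simp
  show ?case
  proof (cases n)
    case 0
    \<comment> \<open>Being below \<open>\<alpha> ^ 0\<close>, which is 1, the element must be 0,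
      the value of the empty sum.\<close>
    have "real k + \<alpha> * x = 0"
      using nat_poly_values_ge_one[OF nat_poly_values_pCons[OF pCons(1), of k]] pCons.prems 0 assms(3)
      by fastforce
    then show ?thesis using 0 by simp
  next
    case (Suc l)
    have "\<alpha> * x < \<alpha> * \<alpha> ^ l" using pCons.prems Suc by simp
    then have "x < \<alpha> ^ l" using assms(3) by simp
    from pCons.IH[OF this] obtain f :: "nat \<Rightarrow> nat" where "x = (\<Sum>i<l. real (f i) * \<alpha> ^ i)" ..
    then have "real k + \<alpha> * x = (\<Sum>i<n. real (case i of 0 \<Rightarrow> k | Suc j \<Rightarrow> f j) * \<alpha> ^ i)"
      unfolding Suc sum.lessThan_Suc_shift by (simp add: sum_distrib_left mult.left_commute)
    then show ?thesis by blast
  qed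
qed

section \<open>Units and atoms\<close>

lemma add_units_nat_poly_values:
  assumes "\<alpha> \<ge> 0"
  shows "add_units (nat_poly_values \<alpha>) = {0}"
proof -
  have "u = 0" if "u \<in> nat_poly_values \<alpha>" "v \<in> nat_poly_values \<alpha>" "u + v = 0" for u v
    using nat_poly_values_nonneg[OF that(1) assms] nat_poly_values_nonneg[OF that(2) assms] that(3)
    by simp
  then show ?thesis unfolding add_units_def by force
qed

lemma add_atoms_nat_poly_values:
  assumes "\<alpha> \<ge> 0"
  shows "x \<in> add_atoms (nat_poly_values \<alpha>) \<longleftrightarrow> x \<in> nat_poly_values \<alpha> \<and> x \<noteq> 0 \<and>
    (\<forall>v\<in>nat_poly_values \<alpha>. \<forall>w\<in>nat_poly_values \<alpha>. x = v + w \<longrightarrow> v = 0 \<or> w = 0)"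
  unfolding add_atoms_def add_units_nat_poly_values[OF assms] by auto

lemma atom_splitD:
  assumes "x \<in> add_atoms (nat_poly_values \<alpha>)" "\<alpha> \<ge> 0"
    and "v \<in> nat_poly_values \<alpha>" "w \<in> nat_poly_values \<alpha>" "x = v + w"
  shows "v = 0 \<or> w = 0"
  using assms add_atoms_nat_poly_values[of \<alpha> x] by blast

lemma atom_is_power:
  assumes "x \<in> add_atoms (nat_poly_values \<alpha>)" "\<alpha> > 1"
  shows "\<exists>n. x = \<alpha> ^ n"
proof -
  have "x \<in> nat_poly_values \<alpha>" "x \<noteq> 0"
    using assms add_atoms_nat_poly_values[of \<alpha> x] by auto
  then obtain n y where y: "y \<in> nat_poly_values \<alpha>" "x = \<alpha> ^ n + y"
    using nat_poly_values_split_power by blast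
  then have "y = 0" using atom_splitD[OF assms(1), of "\<alpha> ^ n" y] assms(2) by simp
  then show ?thesis using y by auto
qed

text \<open>Multiplying a decomposition of the lower power by \<open>\<alpha> ^ (n - k)\<close>
  would decompose \<open>\<alpha> ^ n\<close>.\<close>

lemma power_atom_antimono:
  assumes "\<alpha> ^ n \<in> add_atoms (nat_poly_values \<alpha>)" "k \<le> n" "\<alpha> > 1"
  shows "\<alpha> ^ k \<in> add_atoms (nat_poly_values \<alpha>)"
proof -
  have \<alpha>: "\<alpha> \<ge> 0" using assms(3) by simp
  have "v = 0 \<or> w = 0"
    if vw: "v \<in> nat_poly_values \<alpha>" "w \<in> nat_poly_values \<alpha>" "\<alpha> ^ k = v + w" for v w
  proof -
    have "\<alpha> ^ n = \<alpha> ^ (n - k) * v + \<alpha> ^ (n - k) * w"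
      using assms(2) by (simp flip: distrib_left vw(3) power_add)
    then have "\<alpha> ^ (n - k) * v = 0 \<or> \<alpha> ^ (n - k) * w = 0"
      by (rule atom_splitD[OF assms(1) \<alpha> nat_poly_values_mult_power[OF vw(1)]
            nat_poly_values_mult_power[OF vw(2)]])
    then show ?thesis using assms(3) by simp
  qed
  then show ?thesis unfolding add_atoms_nat_poly_values[OF \<alpha>] using assms(3) by simp
qed

text \<open>Both summands of a proper decomposition are at least 1, hence strictly below
  \<open>\<alpha> ^ n\<close>, so each is a combination of lower powers.\<close>

lemma power_not_atom:
  assumes "\<alpha> ^ n \<notin> add_atoms (nat_poly_values \<alpha>)" "\<alpha> > 1"
  shows "\<exists>f :: nat \<Rightarrow> nat. \<alpha> ^ n = (\<Sum>i<n. real (f i) * \<alpha> ^ i)"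
proof -
  have "\<alpha> \<ge> 0" using assms(2) by simp
  from assms(1)[unfolded add_atoms_nat_poly_values[OF this]] assms(2)
  obtain v w where vw: "v \<in> nat_poly_values \<alpha>" "w \<in> nat_poly_values \<alpha>" "\<alpha> ^ n = v + w"
      "v \<noteq> 0" "w \<noteq> 0"
    by auto
  have "v \<ge> 1" "w \<ge> 1" using vw assms(2) by (auto intro: nat_poly_values_ge_one)
  then have "v < \<alpha> ^ n" "w < \<alpha> ^ n" using vw(3) by auto
  then obtain f g :: "nat \<Rightarrow> nat"
    where "v = (\<Sum>i<n. real (f i) * \<alpha> ^ i)" "w = (\<Sum>i<n. real (g i) * \<alpha> ^ i)"
    using nat_poly_values_below_power vw assms(2) by metis
  then have "\<alpha> ^ n = (\<Sum>i<n. real (f i + g i) * \<alpha> ^ i)"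
    using vw(3) by (simp add: sum.distrib algebra_simps)
  then show ?thesis by (rule exI[where x = "\<lambda>i. f i + g i"])
qed

section \<open>Integer relations among the powers of \<alpha>, and which powers are atoms\<close>

lemma cubic_minimal_independent:
  fixes p q r :: int
  assumes "is_minimal_polynomial m \<alpha>" "degree m = 3"
    and "of_int p + of_int q * \<alpha> + of_int r * \<alpha> ^ 2 = 0"
  shows "p = 0 \<and> q = 0 \<and> r = 0"
proof (rule ccontr)
  assume nonzero: "\<not> ?thesis"
  \<comment> \<open>A nontrivial relation would be a nonzero polynomial of degree at most 2
    vanishing at \<alpha>, against the minimality of \<open>m\<close>.\<close>
  define h :: "rat poly" where "h = [:of_int p, of_int q, of_int r:]"
  have "h \<noteq> 0" using nonzero by (auto simp: h_def)
  moreover have "map_poly of_rat h = ([:of_int p, of_int q, of_int r:] :: real poly)"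
    by (simp add: h_def map_poly_pCons)
  then have "poly (map_poly of_rat h) \<alpha> = 0"
    using assms(3) by (simp add: algebra_simps power2_eq_square)
  ultimately have "3 \<le> degree h" using assms(1,2) unfolding is_minimal_polynomial_def by metis
  then show False by (simp add: h_def split: if_splits)
qed

context
  fixes \<alpha> :: real and a b c :: int
  assumes gt_1: "\<alpha> > 1" and pos: "a > 0" "b > 0" "c > 0"
    and root: "\<alpha> ^ 3 = of_int a * \<alpha> ^ 2 - of_int b * \<alpha> + of_int c"
    and independent: "\<And>p q r :: int. of_int p + of_int q * \<alpha> + of_int r * \<alpha> ^ 2 = 0 \<Longrightarrow>
      p = 0 \<and> q = 0 \<and> r = 0"
begin

lemma root_4: "\<alpha> ^ 4 = of_int a * \<alpha> ^ 3 - of_int b * \<alpha> ^ 2 + of_int c * \<alpha>"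
proof -
  have "\<alpha> ^ 4 = \<alpha> * \<alpha> ^ 3" by (simp add: power_numeral_reduce)
  also have "\<dots> = \<alpha> * (of_int a * \<alpha> ^ 2 - of_int b * \<alpha> + of_int c)" by (simp only: root)
  also have "\<dots> = of_int a * \<alpha> ^ 3 - of_int b * \<alpha> ^ 2 + of_int c * \<alpha>"
    by (simp add: algebra_simps power_numeral_reduce)
  finally show ?thesis .
qed

text \<open>Eliminating the cube by \<open>root\<close> leaves a quadratic relation, whose
  coefficients vanish by \<open>independent\<close>. Thus every integer relation of degree at most 3
  is \<open>d3\<close> times the minimal polynomial.\<close>

lemma cubic_relation_unique:
  fixes d0 d1 d2 d3 :: int
  assumes "of_int d0 + of_int d1 * \<alpha> + of_int d2 * \<alpha> ^ 2 + of_int d3 * \<alpha> ^ 3 = 0"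
  shows "d0 = - c * d3 \<and> d1 = b * d3 \<and> d2 = - a * d3"
proof -
  have "of_int (d0 + c * d3) + of_int (d1 - b * d3) * \<alpha> + of_int (d2 + a * d3) * \<alpha> ^ 2 = 0"
    using assms unfolding root by (simp add: algebra_simps)
  from independent[OF this] show ?thesis by simp
qed

text \<open>The left side is the minimal polynomial at 1. Were it 0, the factor X - 1 would split
  off, and the quadratic cofactor would vanish at \<alpha>.\<close>

lemma one_not_root: "1 - a + b - c \<noteq> 0"
proof
  assume "1 - a + b - c = 0"
  then have b: "b = a + c - 1" by simp
  have "(\<alpha> - 1) * (of_int c + of_int (1 - a) * \<alpha> + of_int 1 * \<alpha> ^ 2) = 0"
    using root unfolding b by (simp add: algebra_simps power_numeral_reduce)
  then have "of_int c + of_int (1 - a) * \<alpha> + of_int 1 * \<alpha> ^ 2 = 0" using gt_1 by simp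
  from independent[OF this] show False by simp
qed

text \<open>A decomposition would give a relation with \<open>d3 = 1\<close> whose linear
  coefficient \<open>- int (f 1)\<close> equals \<open>b\<close>, although \<open>b\<close> is
  positive.\<close>

lemma cube_atom: "\<alpha> ^ 3 \<in> add_atoms (nat_poly_values \<alpha>)"
proof (rule ccontr)
  assume "\<alpha> ^ 3 \<notin> add_atoms (nat_poly_values \<alpha>)"
  then obtain f :: "nat \<Rightarrow> nat" where "\<alpha> ^ 3 = (\<Sum>i<3. real (f i) * \<alpha> ^ i)"
    using power_not_atom gt_1 by blast
  then have "of_int (- int (f 0)) + of_int (- int (f 1)) * \<alpha> + of_int (- int (f 2)) * \<alpha> ^ 2
      + of_int 1 * \<alpha> ^ 3 = 0"
    by (simp add: eval_nat_numeral)
  from cubic_relation_unique[OF this] show False using pos by simp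
qed

text \<open>The integer \<open>k\<close> is the constant of the multiplier X + k of the minimal
  polynomial. The three inequalities say that the coefficients of X^3, X^2 and X in the product are
  not positive.\<close>

lemma fourth_power_atom_iff:
  "\<alpha> ^ 4 \<in> add_atoms (nat_poly_values \<alpha>) \<longleftrightarrow> \<not> (\<exists>k. k \<le> a \<and> b \<le> k * a \<and> k * b \<le> c)"
proof
  assume atom: "\<alpha> ^ 4 \<in> add_atoms (nat_poly_values \<alpha>)"
  show "\<not> (\<exists>k. k \<le> a \<and> b \<le> k * a \<and> k * b \<le> c)"
  proof
    assume "\<exists>k. k \<le> a \<and> b \<le> k * a \<and> k * b \<le> c"
    then obtain k where k: "k \<le> a" "b \<le> k * a" "k * b \<le> c" by blast
    have "0 < k" using k(2) pos by (metis less_le_trans zero_less_mult_pos2)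
    \<comment> \<open>The relation from (X + k) m is split into its constant term \<open>v\<close>
      and the rest \<open>w\<close>; by the choice of \<open>k\<close> no \<open>nat\<close>
      truncates.\<close>
    define v where "v = of_nat (nat (k * c)) * \<alpha> ^ 0"
    define w where "w = of_nat (nat (c - k * b)) * \<alpha> ^ 1 + of_nat (nat (k * a - b)) * \<alpha> ^ 2
      + of_nat (nat (a - k)) * \<alpha> ^ 3"
    have "v \<in> nat_poly_values \<alpha>" "w \<in> nat_poly_values \<alpha>"
      unfolding v_def w_def
      by (intro nat_poly_values_add nat_poly_values_mult_nat nat_poly_values_power)+
    moreover have v: "v = of_int (k * c)" using \<open>0 < k\<close> pos by (simp add: v_def)
    have w: "w = of_int (c - k * b) * \<alpha> + of_int (k * a - b) * \<alpha> ^ 2 + of_int (a - k) * \<alpha> ^ 3"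
      using k by (simp add: w_def)
    have "\<alpha> ^ 4 = v + w"
      unfolding v w root_4 unfolding root by (simp add: algebra_simps)
    ultimately have "v = 0 \<or> w = 0"
      using atom_splitD[OF atom] gt_1 by simp
    moreover have "v \<noteq> 0" using v \<open>0 < k\<close> pos by simp
    ultimately have "w = 0" by blast
    \<comment> \<open>A zero \<open>w\<close> forces the minimal polynomial to be (X - k)(X^2 +
      k^2), so \<alpha> would be the integer \<open>k\<close>, contradicting
      \<open>independent\<close>.\<close>
    then have "of_int 0 + of_int (c - k * b) * \<alpha> + of_int (k * a - b) * \<alpha> ^ 2
        + of_int (a - k) * \<alpha> ^ 3 = 0" using w by simp
    from cubic_relation_unique[OF this] have "0 = c * (a - k)" "c - k * b = b * (a - k)"
        "k * a - b = - a * (a - k)"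
      by simp_all
    then have eqs: "a = k" "b = k * k" "c = k * (k * k)" using pos by auto
    then have "(\<alpha> - of_int k) * (\<alpha> ^ 2 + of_int k ^ 2) = 0"
      using root unfolding eqs by (simp add: algebra_simps power_numeral_reduce)
    moreover have "\<alpha> ^ 2 + of_int k ^ 2 \<noteq> 0" using gt_1 by (simp add: sum_power2_eq_zero_iff)
    ultimately have "\<alpha> = of_int k" by (metis eq_iff_diff_eq_0 mult_eq_0_iff)
    then have "of_int (- k) + of_int 1 * \<alpha> + of_int 0 * \<alpha> ^ 2 = 0" by simp
    from independent[OF this] show False by simp
  qed
next
  assume no_k: "\<not> (\<exists>k. k \<le> a \<and> b \<le> k * a \<and> k * b \<le> c)"
  show "\<alpha> ^ 4 \<in> add_atoms (nat_poly_values \<alpha>)"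
  proof (rule ccontr)
    assume "\<alpha> ^ 4 \<notin> add_atoms (nat_poly_values \<alpha>)"
    then obtain f :: "nat \<Rightarrow> nat" where "\<alpha> ^ 4 = (\<Sum>i<4. real (f i) * \<alpha> ^ i)"
      using power_not_atom gt_1 by blast
    then have "of_int (- int (f 0)) + of_int (c - int (f 1)) * \<alpha> + of_int (- b - int (f 2)) * \<alpha> ^ 2
        + of_int (a - int (f 3)) * \<alpha> ^ 3 = 0"
      unfolding root_4 by (simp add: eval_nat_numeral algebra_simps)
    \<comment> \<open>The multiplier sought is \<open>a - int (f 3)\<close>; it is at most
      \<open>a\<close> because \<open>f 3\<close> is natural, and \<open>f 1\<close> and
      \<open>f 2\<close> yield the other two bounds.\<close>
    from cubic_relation_unique[OF this]
    have "c - int (f 1) = b * (a - int (f 3))" "- b - int (f 2) = - a * (a - int (f 3))"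
      by auto
    then have "b \<le> (a - int (f 3)) * a" "(a - int (f 3)) * b \<le> c"
      by (simp_all add: algebra_simps)
    then show False using no_k by (metis diff_le_eq le_add_same_cancel1 of_nat_0_le_iff)
  qed
qed

section \<open>Factorizations and their lengths\<close>

lemma not_LFM_if_fourth_power_atom:
  assumes "\<alpha> ^ 4 \<in> add_atoms (nat_poly_values \<alpha>)"
  shows "\<not> LFM (nat_poly_values \<alpha>)"
proof
  assume LFM: "LFM (nat_poly_values \<alpha>)"
  have atoms: "\<alpha> ^ i \<in> add_atoms (nat_poly_values \<alpha>)" if "i \<le> 4" for i
    using power_atom_antimono[OF assms that gt_1] .
  \<comment> \<open>\<open>A\<close> and \<open>B\<close> collect the positive and the negative
    terms of (X - 1) m = X^4 - (a + 1) X^3 + (a + b) X^2 - (b + c) X + c. The factor X - 1 makes the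
    coefficients sum to 0, so the sizes agree.\<close>
  define A where "A = replicate_mset 1 (\<alpha> ^ 4) + replicate_mset (nat (a + b)) (\<alpha> ^ 2)
    + replicate_mset (nat c) (\<alpha> ^ 0)"
  define B where "B = replicate_mset (nat (a + 1)) (\<alpha> ^ 3) + replicate_mset (nat (b + c)) (\<alpha> ^ 1)"
  have "sum_mset A = \<alpha> ^ 4 + of_int (a + b) * \<alpha> ^ 2 + of_int c"
    using pos by (simp add: A_def)
  moreover have "sum_mset B = of_int (a + 1) * \<alpha> ^ 3 + of_int (b + c) * \<alpha>"
    using pos by (simp add: B_def)
  ultimately have "sum_mset A = sum_mset B"
    unfolding root_4 unfolding root by (simp add: algebra_simps)
  have "set_mset A \<subseteq> add_atoms (nat_poly_values \<alpha>)" "set_mset B \<subseteq> add_atoms (nat_poly_values \<alpha>)"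
    using atoms[of 0] atoms[of 1] atoms[of 2] atoms[of 3] atoms[of 4]
    by (auto simp: A_def B_def split: if_splits)
  moreover have "A \<noteq> {#}" "B \<noteq> {#}" using pos by (auto simp: A_def B_def)
  ultimately have fact: "A \<in> factorizations (nat_poly_values \<alpha>) (sum_mset B)"
    "B \<in> factorizations (nat_poly_values \<alpha>) (sum_mset B)"
    using \<open>sum_mset A = sum_mset B\<close> by (auto simp: factorizations_def)
  have B: "sum_mset B = of_nat (nat (a + 1)) * \<alpha> ^ 3 + of_nat (nat (b + c)) * \<alpha> ^ 1"
    by (simp add: B_def)
  have mem: "sum_mset B \<in> nat_poly_values \<alpha>"
    unfolding B by (intro nat_poly_values_add nat_poly_values_mult_nat nat_poly_values_power)
  have nonzero: "sum_mset B \<noteq> 0"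
  proof -
    have "sum_mset B > 0" unfolding B using pos gt_1 by (intro add_pos_pos mult_pos_pos) auto
    then show ?thesis by simp
  qed
  have "A \<noteq> B"
  proof -
    have "\<alpha> ^ 4 \<in># A" by (simp add: A_def)
    moreover have "\<alpha> ^ 4 \<noteq> \<alpha> ^ 3" "\<alpha> ^ 4 \<noteq> \<alpha> ^ 1"
      using power_inject_exp[OF gt_1, of 4 3] power_inject_exp[OF gt_1, of 4 1] by simp_all
    then have "\<alpha> ^ 4 \<notin># B" by (auto simp: B_def split: if_splits)
    ultimately show ?thesis by metis
  qed
  moreover have "size A = size B" using pos by (simp add: A_def B_def)
  ultimately show False
    using LFM[unfolded LFM_def, THEN conjunct2, rule_format, OF mem nonzero fact] by simp
qed

lemma LFM_if_fourth_power_not_atom: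
  assumes "\<alpha> ^ 4 \<notin> add_atoms (nat_poly_values \<alpha>)" "atomic_monoid (nat_poly_values \<alpha>)"
  shows "LFM (nat_poly_values \<alpha>)"
proof -
  define S where "S = (\<lambda>i. \<alpha> ^ i) ` {..<4::nat}"
  have inj: "inj_on (\<lambda>i. \<alpha> ^ i) {..<4::nat}"
    using power_inject_exp[OF gt_1] by (auto simp: inj_on_def)
  have "finite S" by (simp add: S_def)
  have S: "add_atoms (nat_poly_values \<alpha>) \<subseteq> S"
  proof
    fix x assume x: "x \<in> add_atoms (nat_poly_values \<alpha>)"
    then obtain n where n: "x = \<alpha> ^ n" using atom_is_power gt_1 by blast
    \<comment> \<open>A higher power that is an atom would make \<open>\<alpha> ^ 4\<close> an atom
      as well.\<close>
    then have "n < 4" using x assms(1) power_atom_antimono[of \<alpha> n 4] gt_1 by force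
    then show "x \<in> S" using n by (simp add: S_def)
  qed
  have unique: "A = B" if AB: "A \<in> factorizations (nat_poly_values \<alpha>) x"
    "B \<in> factorizations (nat_poly_values \<alpha>) x" "size A = size B" for A B x
  proof -
    have AS: "set_mset A \<subseteq> S" "set_mset B \<subseteq> S" and eq: "sum_mset A = sum_mset B"
      using AB S by (auto simp: factorizations_def)
    \<comment> \<open>The differences of multiplicities are the coefficients of a polynomial of
      degree at most 3: equal sums make it vanish at \<alpha>, equal sizes make it vanish at
      1.\<close>
    define d where "d i = int (count A (\<alpha> ^ i)) - int (count B (\<alpha> ^ i))" for i :: nat
    have "(\<Sum>i<4. of_int (d i) * \<alpha> ^ i) = 0"
      using eq unfolding sum_mset_eq_sum_count[OF \<open>finite S\<close> AS(1)]
        sum_mset_eq_sum_count[OF \<open>finite S\<close> AS(2)] unfolding S_def sum.reindex[OF inj]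
      by (simp add: d_def sum_subtractf algebra_simps)
    then have "of_int (d 0) + of_int (d 1) * \<alpha> + of_int (d 2) * \<alpha> ^ 2 + of_int (d 3) * \<alpha> ^ 3 = 0"
      by (simp add: eval_nat_numeral)
    from cubic_relation_unique[OF this]
    have d: "d 0 = - c * d 3" "d 1 = b * d 3" "d 2 = - a * d 3" by auto
    have "int (\<Sum>i<4::nat. count A (\<alpha> ^ i)) = int (\<Sum>i<4::nat. count B (\<alpha> ^ i))"
      using AB(3) unfolding size_eq_sum_count[OF \<open>finite S\<close> AS(1)]
        size_eq_sum_count[OF \<open>finite S\<close> AS(2)] unfolding S_def sum.reindex[OF inj] by simp
    then have "d 0 + d 1 + d 2 + d 3 = 0"
      by (simp add: eval_nat_numeral d_def)
    \<comment> \<open>The polynomial is \<open>d 3\<close> times the minimal polynomial, evaluated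
      here at 1.\<close>
    then have "(1 - a + b - c) * d 3 = 0" unfolding d by (simp add: algebra_simps)
    then have "d 3 = 0" using one_not_root by simp
    then have "d i = 0" if "i < 4" for i
      using that d by (auto simp: eval_nat_numeral less_Suc_eq)
    then have "count A y = count B y" if "y \<in> S" for y
      using that by (auto simp: S_def d_def)
    moreover have "count A y = count B y" if "y \<notin> S" for y
      using that AS by (metis in_mono not_in_iff)
    ultimately show "A = B" by (intro multiset_eqI) blast
  qed
  show ?thesis
    unfolding LFM_def using assms(2) unique by metis
qed

text \<open>Moving the negative terms of the minimal polynomial to the other side gives two
  factorizations of \<open>\<alpha> ^ 3 + b * \<alpha>\<close>, all of whose powers are atoms by
  \<open>cube_atom\<close>.\<close>

lemma not_UFM: "\<not> UFM (nat_poly_values \<alpha>)"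
proof
  assume UFM: "UFM (nat_poly_values \<alpha>)"
  have atoms: "\<alpha> ^ i \<in> add_atoms (nat_poly_values \<alpha>)" if "i \<le> 3" for i
    using power_atom_antimono[OF cube_atom that gt_1] .
  define A where "A = replicate_mset 1 (\<alpha> ^ 3) + replicate_mset (nat b) (\<alpha> ^ 1)"
  define B where "B = replicate_mset (nat a) (\<alpha> ^ 2) + replicate_mset (nat c) (\<alpha> ^ 0)"
  have "sum_mset A = \<alpha> ^ 3 + of_int b * \<alpha>" "sum_mset B = of_int a * \<alpha> ^ 2 + of_int c"
    using pos by (simp_all add: A_def B_def)
  then have "sum_mset A = sum_mset B" by (simp add: root)
  have "set_mset A \<subseteq> add_atoms (nat_poly_values \<alpha>)" "set_mset B \<subseteq> add_atoms (nat_poly_values \<alpha>)"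
    using atoms[of 0] atoms[of 1] atoms[of 2] atoms[of 3]
    by (auto simp: A_def B_def split: if_splits)
  moreover have "A \<noteq> {#}" "B \<noteq> {#}" using pos by (auto simp: A_def B_def)
  ultimately have fact: "A \<in> factorizations (nat_poly_values \<alpha>) (sum_mset A)"
    "B \<in> factorizations (nat_poly_values \<alpha>) (sum_mset A)"
    using \<open>sum_mset A = sum_mset B\<close> by (auto simp: factorizations_def)
  have A: "sum_mset A = \<alpha> ^ 3 + of_nat (nat b) * \<alpha> ^ 1"
    by (simp add: A_def)
  have mem: "sum_mset A \<in> nat_poly_values \<alpha>"
    unfolding A by (intro nat_poly_values_add nat_poly_values_mult_nat nat_poly_values_power)
  have nonzero: "sum_mset A \<noteq> 0"
  proof -
    have "sum_mset A > 0" unfolding A using pos gt_1 by (intro add_pos_pos mult_pos_pos) auto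
    then show ?thesis by simp
  qed
  have "A \<noteq> B"
  proof -
    have "\<alpha> ^ 3 \<in># A" by (simp add: A_def)
    moreover have "\<alpha> ^ 3 \<noteq> \<alpha> ^ 2" "\<alpha> ^ 3 \<noteq> \<alpha> ^ 0"
      using power_inject_exp[OF gt_1, of 3 2] power_inject_exp[OF gt_1, of 3 0] by simp_all
    then have "\<alpha> ^ 3 \<notin># B" by (auto simp: B_def split: if_splits)
    ultimately show ?thesis by metis
  qed
  with UFM[unfolded UFM_def, THEN conjunct2, rule_format, OF mem nonzero] fact
  show False by blast
qed

end

section \<open>The arithmetic criterion and the conclusion\<close>

lemma exists_multiplier_iff:
  fixes a b c :: int
  assumes "a > 0" "b > 0"
  shows "(\<exists>k. k \<le> a \<and> b \<le> k * a \<and> k * b \<le> c) \<longleftrightarrow>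
    b \<le> a ^ 2 \<and> of_int b / of_int a \<le> (of_int \<lfloor>of_int c / of_int b :: real\<rfloor> :: real)"
proof -
  have le_floor: "k * b \<le> c \<longleftrightarrow> k \<le> \<lfloor>of_int c / of_int b :: real\<rfloor>" for k
    using assms by (simp add: le_floor_iff pos_le_divide_eq flip: of_int_mult)
  have div_le: "of_int b / of_int a \<le> (of_int k :: real) \<longleftrightarrow> b \<le> k * a" for k
    using assms by (simp add: pos_divide_le_eq flip: of_int_mult)
  \<comment> \<open>The lower bound on \<open>k\<close> persists when \<open>k\<close> grows, so it
    suffices to test the largest admissible \<open>k\<close>, the minimum of \<open>a\<close> and
    the floor. It holds at the minimum iff it holds at both.\<close>
  have "b \<le> l * a" if "b \<le> k * a" "k \<le> l" for k l
    using that assms by (meson mult_right_mono order.trans order_less_imp_le)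
  then have "(\<exists>k. k \<le> a \<and> b \<le> k * a \<and> k \<le> l) \<longleftrightarrow> b \<le> a * a \<and> b \<le> l * a" for l
    by (metis linear order_refl)
  then show ?thesis unfolding le_floor div_le power2_eq_square .
qed

theorem proposition14:
  fixes \<alpha> :: real and a b c :: int and m :: "rat poly"
  assumes "\<alpha> > 1" and "algebraic \<alpha>"
    and "a > 0" and "b > 0" and "c > 0"
    and "m = [:- of_int c, of_int b, - of_int a, 1:]"
    and "is_minimal_polynomial m \<alpha>"
    and "\<forall>x::real. x > 0 \<and> poly (map_poly of_rat m) x = 0 \<longrightarrow> x = \<alpha>"
    and "atomic_monoid (nat_poly_values \<alpha>)"
  shows "proper_LFM (nat_poly_values \<alpha>) \<longleftrightarrow>
           b \<le> a ^ 2 \<and> of_int b / of_int a \<le> (of_int \<lfloor>of_int c / of_int b :: real\<rfloor> :: real)"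
proof -
  have "map_poly of_rat m = ([:- of_int c, of_int b, - of_int a, 1:] :: real poly)"
    by (simp add: assms(6) map_poly_pCons of_rat_minus)
  moreover have "poly (map_poly of_rat m) \<alpha> = 0"
    using assms(7) by (simp add: is_minimal_polynomial_def)
  ultimately have root: "\<alpha> ^ 3 = of_int a * \<alpha> ^ 2 - of_int b * \<alpha> + of_int c"
    by (simp add: algebra_simps power_numeral_reduce)
  have "degree m = 3" by (simp add: assms(6))
  note independent = cubic_minimal_independent[OF assms(7) this]
  note hyps = assms(1,3-5) root independent
  \<comment> \<open>Since \<open>not_UFM\<close> holds in every case, being a proper LFM reduces to
    being an LFM.\<close>
  have "proper_LFM (nat_poly_values \<alpha>) \<longleftrightarrow> \<alpha> ^ 4 \<notin> add_atoms (nat_poly_values \<alpha>)"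
    using not_LFM_if_fourth_power_atom[OF hyps] LFM_if_fourth_power_not_atom[OF hyps _ assms(9)]
      not_UFM[OF hyps]
    unfolding proper_LFM_def by blast
  then show ?thesis
    using fourth_power_atom_iff[OF hyps] exists_multiplier_iff[OF assms(3,4)] by simp
qed

end
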